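(* Let $f_\omega$ be the infinite Fibonacci word and let $(w_n)_{n\ge -1}$ be its singular words. The closed $z$-factorization of $f_\omega$ is $$cz(f_\omega)=(w_{-1},\,w_0,\,w_1,\,\ldots).$$
   Context: Finite Fibonacci words: $f_{-1}=1$, $f_0=0$, $f_n=f_{n-1}f_{n-2}$ for $n\ge 1$ (words over $\{0,1\}$); $f_\omega=\lim_{n\to\infty} f_n$ is the infinite Fibonacci word. Singular words: $w_{-2}=\varepsilon$ (empty word), $w_{-1}=0$, $w_0=1$, and for $n\ge 1$, $w_n=a f_n b^{-1}$ where $ab\in\{01,10\}$ is the length-2 suffix of $f_n$ (so $f_n b^{-1}$ is $f_n$ with its last letter $b$ removed). A word $x$ is a border of $w$ if it is nonempty and both a prefix and a suffix of $w$. A nonempty finite word $w$ is closed if it is a single letter or it has a border $x$ that occurs exactly twice in $w$ (occurrences may overlap). The closed $z$-factorization of an infinite word $\boldsymbol w$ is the factorization $cz(\boldsymbol w)=(z_1,z_2,\ldots)$ with $\boldsymbol w=z_1z_2\cdots$, where for each $i$, $z_i$ is the shortest closed prefix of $z_iz_{i+1}\cdots$ that occurs exactly once in $z_1z_2\cdots z_i$. *)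

theory Defs
  imports "HOL-Library.Sublist" "HOL-Library.Omega_Words_Fun"
begin

text \<open>Finite words are lists and infinite words are functions on \<^typ>\<open>nat\<close> (type \<open>'a word\<close>).
  Both imported theories define \<open>prefix\<close> and \<open>suffix\<close>, hence the qualified names below.\<close>

definition word_limit :: "(nat \<Rightarrow> 'a list) \<Rightarrow> 'a word \<Rightarrow> bool" where
  "word_limit u w \<longleftrightarrow> (\<forall>i. \<forall>\<^sub>F n in sequentially. i < length (u n) \<and> u n ! i = w i)"

lemma word_limit_unique:
  assumes "word_limit u v" "word_limit u w"
  shows "v = w"
proof
  fix i
  have "\<forall>\<^sub>F n in sequentially. u n ! i = v i \<and> u n ! i = w i"
    using eventually_conj[OF assms[unfolded word_limit_def, THEN spec[of _ i]]]
    by (rule eventually_mono) blast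
  then have "\<exists>n. u n ! i = v i \<and> u n ! i = w i"
    by (rule eventually_happens'[OF sequentially_bot])
  then show "v i = w i"
    by auto
qed

text \<open>The words are indexed from \<open>-1\<close>; the value at arguments below \<open>-1\<close> is irrelevant.\<close>

function fib_word :: "int \<Rightarrow> nat list" where
  "fib_word n = (if n \<le> -1 then [1] else if n = 0 then [0] else fib_word (n - 1) @ fib_word (n - 2))"
  by auto
termination by (relation "measure (\<lambda>n. nat (n + 1))") auto

declare fib_word.simps [simp del]

definition fib_omega :: "nat word" where
  "fib_omega = (THE w. word_limit (\<lambda>n. fib_word (int n)) w)"

lemma fib_word_Suc: "fib_word (int (Suc n)) = fib_word (int n) @ fib_word (int n - 1)"
  by (subst fib_word.simps) (simp add: algebra_simps)

lemma length_fib_word: "n < length (fib_word (int n))"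
proof (induction n)
  case 0
  show ?case by (simp add: fib_word.simps[of 0])
next
  case (Suc n)
  have "fib_word k \<noteq> []" for k
  proof (induction k rule: fib_word.induct)
    case (1 n)
    then show ?case by (subst fib_word.simps) (simp split: if_split)
  qed
  then have "0 < length (fib_word (int n - 1))" by simp
  with Suc show ?case unfolding fib_word_Suc length_append by linarith
qed

lemma prefix_fib_word:
  "m \<le> n \<Longrightarrow> Sublist.prefix (fib_word (int m)) (fib_word (int n))"
proof (induction n rule: dec_induct)
  case (step n)
  from step.IH show ?case unfolding fib_word_Suc by (rule prefix_prefix)
qed simp

lemma word_limit_fib_omega: "word_limit (\<lambda>n. fib_word (int n)) fib_omega"
proof -
  have "word_limit (\<lambda>n. fib_word (int n)) (\<lambda>i. fib_word (int i) ! i)"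
    unfolding word_limit_def
  proof
    fix i
    have "i < length (fib_word (int n)) \<and> fib_word (int n) ! i = fib_word (int i) ! i"
      if "i \<le> n" for n
      using prefix_fib_word[OF that] length_fib_word[of i] by (auto simp: prefix_def nth_append)
    then show "\<forall>\<^sub>F n in sequentially.
        i < length (fib_word (int n)) \<and> fib_word (int n) ! i = fib_word (int i) ! i"
      by (rule eventually_sequentiallyI)
  qed
  then show ?thesis
    unfolding fib_omega_def
    by (blast intro: theI[where P = "word_limit (\<lambda>n. fib_word (int n))"] word_limit_unique)
qed

text \<open>For \<open>n \<ge> 1\<close> the first letter \<open>a\<close> is the penultimate letter of \<open>f\<^sub>n\<close>. Words of index
  at least \<open>-2\<close> are meant.\<close>

definition singular_word :: "int \<Rightarrow> nat list" where
  "singular_word n =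
    (if n \<le> -2 then []
     else if n = -1 then [0]
     else if n = 0 then [1]
     else last (butlast (fib_word n)) # butlast (fib_word n))"

text \<open>Number of (possibly overlapping) occurrences of \<open>x\<close> as a factor of \<open>w\<close>.\<close>

definition occurrences :: "'a list \<Rightarrow> 'a list \<Rightarrow> nat" where
  "occurrences x w = card {i. i \<le> length w \<and> Sublist.prefix x (drop i w)}"

definition border :: "'a list \<Rightarrow> 'a list \<Rightarrow> bool" where
  "border x w \<longleftrightarrow> x \<noteq> [] \<and> Sublist.prefix x w \<and> Sublist.suffix x w"

definition closed_word :: "'a list \<Rightarrow> bool" where
  "closed_word w \<longleftrightarrow>
    w \<noteq> [] \<and> (length w = 1 \<or> (\<exists>x. border x w \<and> occurrences x w = 2))"

text \<open>\<open>z i\<close> is the factor with number \<open>i + 1\<close>. The first conjunct says that \<open>w\<close> is the infinite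
  product of the \<open>z i\<close>. A prefix \<open>p\<close> of the remaining infinite word qualifies as the next
  factor if it is closed and occurs exactly once (namely as the final factor) in the product
  of the previous factors followed by \<open>p\<close>.\<close>

definition closed_z_factorization :: "'a word \<Rightarrow> (nat \<Rightarrow> 'a list) \<Rightarrow> bool" where
  "closed_z_factorization w z \<longleftrightarrow>
    word_limit (\<lambda>n. concat (map z [0..<n])) w \<and>
    (\<forall>i. is_arg_min length
      (\<lambda>p. (\<exists>v. w = (concat (map z [0..<i]) @ p) \<frown> v) \<and> closed_word p \<and>
        occurrences p (concat (map z [0..<i]) @ p) = 1)
      (z i))"

end

theory Submission
  imports Defs "HOL-Library.Multiset"
begin

text \<open>Write \<open>\<pi>\<^sub>n\<close> for \<open>f\<^sub>n\<close> without its last two letters. Since \<open>f\<^sub>n f\<^sub>n\<^sub>-\<^sub>1\<close> and \<open>f\<^sub>n\<^sub>-\<^sub>1 f\<^sub>n\<close> differ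
  only in their last two letters, \<open>\<pi>\<^sub>n\<^sub>+\<^sub>2\<close> is a prefix of \<open>f\<^sub>n f\<^sub>n f\<^sub>n\<close>, so all its factors of length
  \<open>\<bar>f\<^sub>n\<bar>\<close> are conjugates of \<open>f\<^sub>n\<close>. The singular word \<open>w\<^sub>n\<close> arises from a conjugate of \<open>f\<^sub>n\<close> by
  exchanging one letter, hence it is not a factor of \<open>\<pi>\<^sub>n\<^sub>+\<^sub>2\<close>. This gives both that \<open>w\<^sub>n\<close> occurs
  only as a suffix in \<open>w\<^sub>-\<^sub>1 \<cdots> w\<^sub>n\<close>, which is \<open>f\<^sub>n\<^sub>+\<^sub>2\<close> without its last letter, and that \<open>w\<^sub>n\<close>
  occurs in \<open>w\<^sub>n\<^sub>+\<^sub>2 = a \<pi>\<^sub>n\<^sub>+\<^sub>2 a\<close> only as a prefix and as a suffix. Finally, all proper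
  prefixes of \<open>w\<^sub>n\<close> are factors of \<open>w\<^sub>-\<^sub>1 \<cdots> w\<^sub>n\<^sub>-\<^sub>1\<close>.\<close>

section \<open>Factors of powers and positions of occurrences\<close>

text \<open>The length condition forces \<open>u = x2 @ x1\<close>, so \<open>x1 @ x2\<close> is a
  conjugate of \<open>u\<close>; only its letter counts are kept.\<close>

lemma mset_eq_of_straddling:
  assumes "Sublist.suffix x1 u" "Sublist.prefix x2 u" "length x1 + length x2 = length u"
  shows "mset (x1 @ x2) = mset u"
proof -
  obtain s where s: "u = s @ x1" using assms(1) by (auto simp: Sublist.suffix_def)
  obtain t where t: "u = x2 @ t" using assms(2) by (auto simp: prefix_def)
  have "length s = length x2" using s assms(3) by simp
  with s t have "s = x2" by (metis append_eq_append_conv)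
  with s show ?thesis by simp
qed

lemma mset_eq_of_sublist_square:
  assumes "sublist x (u @ u)" "length x = length u"
  shows "mset x = mset u"
proof -
  consider "sublist x u"
    | x1 x2 where "x = x1 @ x2" "Sublist.suffix x1 u" "Sublist.prefix x2 u"
    using assms(1) unfolding sublist_append[of x u u] by blast
  then show ?thesis
  proof cases
    case 1
    then show ?thesis using assms(2) by (auto simp: sublist_def)
  next
    case 2
    then show ?thesis using assms(2) mset_eq_of_straddling[of x1 u x2] by simp
  qed
qed

lemma mset_eq_of_sublist_cube:
  assumes "sublist x (u @ u @ u)" "length x = length u"
  shows "mset x = mset u"
proof -
  consider "sublist x u" | "sublist x (u @ u)"
    | x1 x2 where "x = x1 @ x2" "Sublist.suffix x1 u" "Sublist.prefix x2 (u @ u)"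
    using assms(1) unfolding sublist_append[of x u "u @ u"] by blast
  then show ?thesis
  proof cases
    case 1
    then show ?thesis using assms(2) by (auto simp: sublist_def)
  next
    case 2
    then show ?thesis using assms(2) by (rule mset_eq_of_sublist_square)
  next
    case 3
    \<comment> \<open>The length bound confines the overhang to one further copy of
      \<open>u\<close>.\<close>
    then have "length x2 \<le> length u" using assms(2) by simp
    then have "Sublist.prefix x2 u"
      using 3(3) prefix_length_prefix[of x2 "u @ u" u] by simp
    then show ?thesis using 3 assms(2) mset_eq_of_straddling[of x1 u x2] by simp
  qed
qed

text \<open>An occurrence ending before the added letter would lie inside \<open>u\<close>.\<close>

lemma prefix_drop_snoc_not_sublist:
  assumes "Sublist.prefix x (drop i (u @ [c]))" "\<not> sublist x u" "x \<noteq> []"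
  shows "i + length x = Suc (length u)"
proof (rule ccontr)
  assume neq: "i + length x \<noteq> Suc (length u)"
  have "length x \<le> Suc (length u) - i" using prefix_length_le[OF assms(1)] by simp
  moreover have "0 < length x" using assms(3) by simp
  ultimately have le: "i + length x \<le> length u" using neq by arith
  have "Sublist.prefix x (drop i u)"
  proof (rule prefix_length_prefix[OF assms(1)])
    show "Sublist.prefix (drop i u) (drop i (u @ [c]))" by simp
    show "length x \<le> length (drop i u)" using le by simp
  qed
  then have "sublist x (drop i u)" by (rule prefix_imp_sublist)
  then have "sublist x u" using sublist_drop by (rule sublist_order.order_trans)
  with assms(2) show False by contradiction
qed

lemma occurrences_eq_1_iff:
  "occurrences x (u @ x) = 1 \<longleftrightarrow>
    (\<forall>i. i \<le> length (u @ x) \<and> Sublist.prefix x (drop i (u @ x)) \<longrightarrow> i = length u)"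
proof -
  let ?S = "{i. i \<le> length (u @ x) \<and> Sublist.prefix x (drop i (u @ x))}"
  have mem: "length u \<in> ?S" by simp
  show ?thesis
    unfolding occurrences_def
  proof
    assume "card ?S = 1"
    then obtain a where a: "?S = {a}" by (rule card_1_singletonE)
    have "length u \<in> {a}" using mem unfolding a .
    with a have S: "?S = {length u}" by simp
    show "\<forall>i. i \<le> length (u @ x) \<and> Sublist.prefix x (drop i (u @ x)) \<longrightarrow> i = length u"
    proof (intro allI impI)
      fix i assume "i \<le> length (u @ x) \<and> Sublist.prefix x (drop i (u @ x))"
      then have "i \<in> ?S" by (rule CollectI)
      then show "i = length u" unfolding S by (rule singletonD)
    qed
  next
    assume "\<forall>i. i \<le> length (u @ x) \<and> Sublist.prefix x (drop i (u @ x)) \<longrightarrow> i = length u"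
    with mem have "?S = {length u}" by blast
    then show "card ?S = 1" by simp
  qed
qed

section \<open>Fibonacci and singular words with shifted indices\<close>

text \<open>Indices are shifted by one, so that \<open>fib n\<close> is \<open>f\<^sub>n\<^sub>-\<^sub>1\<close> and \<open>sing n\<close> is \<open>w\<^sub>n\<^sub>-\<^sub>1\<close>.\<close>

definition fib :: "nat \<Rightarrow> nat list" where
  "fib n = fib_word (int n - 1)"

definition sing :: "nat \<Rightarrow> nat list" where
  "sing n = last (fib (Suc n)) # butlast (fib n)"

lemma fib_0: "fib 0 = [1]"
  and fib_1: "fib (Suc 0) = [0]"
  and fib_Suc_Suc: "fib (Suc (Suc n)) = fib (Suc n) @ fib n"
  using fib_word_Suc[of n]
  by (simp_all add: fib_def fib_word.simps[of "-1"] fib_word.simps[of 0])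

lemmas fib_simps = fib_0 fib_1 fib_Suc_Suc

lemma fib_nonempty [simp]: "fib n \<noteq> []"
  by (induction n rule: induct_nat_012) (simp_all add: fib_simps)

lemma butlast_fib_nonempty [simp]: "butlast (fib (Suc (Suc n))) \<noteq> []"
  by (simp add: fib_simps butlast_append)

lemma length_fib: "n < length (fib (Suc n))"
  using length_fib_word[of n] by (simp add: fib_def)

lemma last_fib_Suc_Suc: "last (fib (Suc (Suc n))) = last (fib n)"
  by (simp add: fib_Suc_Suc)

lemma last_fib_Suc_neq: "last (fib (Suc n)) \<noteq> last (fib n)"
  by (induction n) (simp_all add: fib_0 fib_1 last_fib_Suc_Suc)

lemma last_butlast_fib: "last (butlast (fib (Suc (Suc n)))) = last (fib (Suc n))"
proof (induction n rule: induct_nat_012)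
  case (ge2 n)
  then show ?case
    by (subst fib_Suc_Suc) (simp add: butlast_append last_fib_Suc_Suc)
qed (simp_all add: fib_simps)

text \<open>From \<open>n = 2\<close> on, the last letter of \<open>fib (Suc n)\<close> is the
  penultimate letter of \<open>fib n\<close>. Taking it from \<open>fib (Suc n)\<close> lets one
  formula also cover the single-letter words at \<open>n = 0\<close> and
  \<open>n = 1\<close>.\<close>

lemma singular_word_eq_sing: "singular_word (int n - 1) = sing n"
proof -
  consider "n = 0" | "n = Suc 0" | m where "n = Suc (Suc m)"
    by (metis not0_implies_Suc)
  then show ?thesis
  proof cases
    case 3
    then have "singular_word (int n - 1) = last (butlast (fib n)) # butlast (fib n)"
      by (simp add: singular_word_def fib_def)
    with 3 show ?thesis
      by (simp add: sing_def last_butlast_fib last_fib_Suc_Suc)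
  qed (simp_all add: singular_word_def sing_def fib_simps)
qed

lemma length_sing: "length (sing n) = length (fib n)"
  by (simp add: sing_def)

text \<open>The last letter of \<open>fib (Suc n)\<close> is moved across the cut, where it
  completes \<open>butlast (fib n)\<close> to \<open>sing n\<close>. Iterated, this makes the
  product of singular words telescope.\<close>

lemma butlast_fib_Suc_Suc: "butlast (fib (Suc (Suc n))) = butlast (fib (Suc n)) @ sing n"
proof -
  have "butlast (fib (Suc (Suc n))) = fib (Suc n) @ butlast (fib n)"
    by (simp add: fib_Suc_Suc butlast_append)
  also have "fib (Suc n) = butlast (fib (Suc n)) @ [last (fib (Suc n))]"
    by simp
  finally show ?thesis by (simp add: sing_def)
qed

lemma concat_sing: "concat (map sing [0..<n]) = butlast (fib (Suc n))"
  by (induction n) (simp_all add: fib_1 butlast_fib_Suc_Suc)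

section \<open>Near-commutation and the position of singular words\<close>

text \<open>Both words of the inductive step begin with \<open>fib (Suc n)\<close>; removing it
  leaves the two sides of the previous case, interchanged.\<close>

lemma fib_near_commute:
  "butlast (butlast (fib (Suc n) @ fib n)) = butlast (butlast (fib n @ fib (Suc n)))"
proof (induction n)
  case (Suc n)
  have "butlast (butlast (fib (Suc (Suc n)) @ fib (Suc n)))
      = fib (Suc n) @ butlast (butlast (fib n @ fib (Suc n)))"
    by (simp add: fib_Suc_Suc butlast_append)
  also have "\<dots> = butlast (butlast (fib (Suc n) @ fib (Suc (Suc n))))"
    unfolding Suc[symmetric] by (simp add: fib_Suc_Suc butlast_append)
  finally show ?case .
qed (simp add: fib_simps)

lemma not_sublist_sing: "\<not> sublist (sing n) (butlast (butlast (fib (Suc (Suc n)))))"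
proof -
  consider "n = 0" | "n = Suc 0" | m where "n = Suc (Suc m)"
    by (metis not0_implies_Suc)
  then show ?thesis
  proof cases
    case 3
    \<comment> \<open>Near-commutation brings a second \<open>fib n\<close> to the front; what
      follows is a prefix of \<open>fib (Suc m)\<close>, hence of \<open>fib n\<close>.\<close>
    have "butlast (butlast (fib (Suc (Suc n))))
        = fib n @ butlast (butlast (fib (Suc m) @ fib n))"
      using 3 by (simp add: fib_Suc_Suc butlast_append)
    also have "\<dots> = fib n @ butlast (butlast (fib n @ fib (Suc m)))"
      using fib_near_commute[of "Suc m"] 3 by simp
    also have "Sublist.prefix \<dots> (fib n @ fib n @ fib (Suc m))"
      by (meson prefix_order.order_trans prefixeq_butlast same_prefix_prefix)
    also have "Sublist.prefix \<dots> (fib n @ fib n @ fib n)"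
      using 3 by (simp add: fib_Suc_Suc)
    finally have "sublist (butlast (butlast (fib (Suc (Suc n))))) (fib n @ fib n @ fib n)"
      by (rule prefix_imp_sublist)
    \<comment> \<open>The two words share \<open>butlast (fib n)\<close> and differ in the one
      remaining letter.\<close>
    moreover have "mset (sing n) \<noteq> mset (fib n)"
    proof -
      have "mset (fib n) = mset (butlast (fib n) @ [last (fib n)])" by simp
      then show ?thesis
        unfolding sing_def using last_fib_Suc_neq[of n] by (simp del: append_butlast_last_id)
    qed
    ultimately show ?thesis
      using mset_eq_of_sublist_cube length_sing sublist_order.order_trans by blast
  qed (auto simp: sing_def fib_simps sublist_Cons_right)
qed

lemma butlast_fib_snoc:
  "butlast (fib (Suc (Suc n))) = butlast (butlast (fib (Suc (Suc n)))) @ [last (fib (Suc n))]"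
  using append_butlast_last_id[OF butlast_fib_nonempty[of n]]
  by (simp add: last_butlast_fib)

text \<open>With one more letter removed the word no longer contains \<open>sing n\<close>, so every
  occurrence must end at the last letter. This serves both uniqueness in the product and
  closedness.\<close>

lemma prefix_drop_butlast_fib:
  assumes "Sublist.prefix (sing n) (drop i (butlast (fib (Suc (Suc n)))))"
  shows "i = length (butlast (fib (Suc n)))"
proof -
  let ?u = "butlast (fib (Suc (Suc n)))"
  have snoc: "?u = butlast ?u @ [last (fib (Suc n))]" by (rule butlast_fib_snoc)
  have ne: "sing n \<noteq> []" by (simp add: sing_def)
  have "Sublist.prefix (sing n) (drop i (butlast ?u @ [last (fib (Suc n))]))"
    using assms by (simp only: snoc[symmetric])
  from this not_sublist_sing ne have "i + length (sing n) = Suc (length (butlast ?u))"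
    by (rule prefix_drop_snoc_not_sublist)
  also have "\<dots> = length (butlast ?u @ [last (fib (Suc n))])" by (simp only: length_append_singleton)
  also have "\<dots> = length ?u" by (simp only: snoc[symmetric])
  finally show ?thesis unfolding butlast_fib_Suc_Suc by simp
qed

lemma occurrences_sing: "occurrences (sing n) (butlast (fib (Suc n)) @ sing n) = 1"
  unfolding occurrences_eq_1_iff
  using prefix_drop_butlast_fib by (simp add: butlast_fib_Suc_Suc)

section \<open>Closedness and minimality of singular words\<close>

lemma closed_sing: "closed_word (sing n)"
proof -
  consider "n = 0" | "n = Suc 0" | m where "n = Suc (Suc m)"
    by (metis not0_implies_Suc)
  then show ?thesis
  proof cases
    case 3
    let ?u = "butlast (fib (Suc m))"
    \<comment> \<open>Behind the first letter stands \<open>butlast (fib (Suc (Suc m)))\<close>, in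
      which the position of \<open>sing m\<close> is known.\<close>
    have sing_n: "sing n = last (fib (Suc m)) # ?u @ sing m"
      using 3 butlast_fib_Suc_Suc[of m] by (simp add: sing_def last_fib_Suc_Suc)
    have pre: "Sublist.prefix (sing m) (sing n)"
    proof (cases m)
      case (Suc k)
      have "?u = fib m @ butlast (fib k)"
        using Suc by (simp add: fib_Suc_Suc butlast_append)
      then show ?thesis unfolding sing_n
        by (simp add: sing_def prefixeq_butlast prefix_prefix)
    qed (subst sing_n, simp add: sing_def fib_simps)
    have suf: "Sublist.suffix (sing m) (sing n)"
      by (simp add: sing_n suffix_ConsI suffix_appendI)
    have "{i. i \<le> length (sing n) \<and> Sublist.prefix (sing m) (drop i (sing n))}
        = {0, Suc (length ?u)}"
    proof (intro equalityI subsetI)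
      fix i assume i: "i \<in> {i. i \<le> length (sing n) \<and> Sublist.prefix (sing m) (drop i (sing n))}"
      show "i \<in> {0, Suc (length ?u)}"
      proof (cases i)
        case (Suc j)
        with i have "Sublist.prefix (sing m) (drop j (butlast (fib (Suc (Suc m)))))"
          by (simp add: sing_n butlast_fib_Suc_Suc)
        then show ?thesis using prefix_drop_butlast_fib Suc by simp
      qed simp
    next
      fix i assume "i \<in> {0, Suc (length ?u)}"
      then show "i \<in> {i. i \<le> length (sing n) \<and> Sublist.prefix (sing m) (drop i (sing n))}"
        using pre by (auto simp: sing_n simp del: length_butlast)
    qed
    then have "occurrences (sing m) (sing n) = 2"
      by (simp add: occurrences_def)
    moreover have "border (sing m) (sing n)"
      using pre suf by (simp add: border_def) (simp add: sing_def)
    ultimately show ?thesis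
      unfolding closed_word_def by (auto simp: sing_n)
  qed (simp_all add: closed_word_def sing_def fib_simps)
qed

lemma strict_prefix_sing_occurs_before:
  assumes "Sublist.prefix p (sing n)" "length p < length (sing n)" "p \<noteq> []"
  shows "occurrences p (butlast (fib (Suc n)) @ p) \<noteq> 1"
proof -
  \<comment> \<open>Words of length one have no nonempty proper prefix, which excludes
    \<open>n = 0\<close> and \<open>n = 1\<close>.\<close>
  have "length (fib n) \<ge> 2" using assms(2,3) by (cases p) (auto simp: length_sing)
  then have "n \<noteq> 0 \<and> n \<noteq> Suc 0" by (intro conjI notI) (simp_all add: fib_0 fib_1)
  then obtain m where n: "n = Suc (Suc m)" by (metis not0_implies_Suc)
  let ?a = "last (fib (Suc m))"
  have sing_n: "sing n = (?a # butlast (butlast (fib n))) @ [?a]"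
    unfolding sing_def n by (subst butlast_fib_snoc) (simp add: last_fib_Suc_Suc)
  have p: "Sublist.prefix p (?a # butlast (butlast (fib n)))"
  proof (rule prefix_length_prefix[OF assms(1)])
    show "Sublist.prefix (?a # butlast (butlast (fib n))) (sing n)"
      unfolding sing_n by (rule prefixI) (rule refl)
    show "length p \<le> length (?a # butlast (butlast (fib n)))"
      using assms(2) unfolding sing_n by simp
  qed
  \<comment> \<open>Near-commutation exposes \<open>sing n\<close> without its last letter, starting
    at the last letter of the leading \<open>fib (Suc m)\<close>.\<close>
  have "butlast (butlast (fib (Suc n))) = butlast (butlast (fib (Suc m) @ fib n))"
    using fib_near_commute[of "Suc m"] n by (simp add: fib_Suc_Suc)
  also have "\<dots> = fib (Suc m) @ butlast (butlast (fib n))"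
    using n by (simp add: butlast_append)
  also have "\<dots> = butlast (fib (Suc m)) @ ?a # butlast (butlast (fib n))"
    by (subst append_butlast_last_id[of "fib (Suc m)", symmetric]) (simp_all del: append_butlast_last_id)
  finally have eq: "butlast (butlast (fib (Suc n))) =
      butlast (fib (Suc m)) @ ?a # butlast (butlast (fib n))" .
  have "butlast (fib (Suc n)) = butlast (butlast (fib (Suc n))) @ [last (fib n)]"
    unfolding n by (rule butlast_fib_snoc)
  then have "butlast (fib (Suc n)) @ p =
      butlast (fib (Suc m)) @ (?a # butlast (butlast (fib n))) @ [last (fib n)] @ p"
    unfolding eq by simp
  then have "drop (length (butlast (fib (Suc m)))) (butlast (fib (Suc n)) @ p) =
      (?a # butlast (butlast (fib n))) @ [last (fib n)] @ p"
    by (metis append_eq_conv_conj)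
  then have "Sublist.prefix p (drop (length (butlast (fib (Suc m)))) (butlast (fib (Suc n)) @ p))"
    using p by (simp only: prefix_prefix)
  \<comment> \<open>Strictness separates this occurrence of \<open>p\<close> from the final
    one.\<close>
  moreover have "length (butlast (fib (Suc m))) < length (butlast (fib (Suc n)))"
    using n length_fib[of m] by (simp add: fib_Suc_Suc)
  ultimately show ?thesis
    unfolding occurrences_eq_1_iff by (metis length_append less_imp_le nat_neq_iff trans_le_add1)
qed

section \<open>Prefixes of the infinite word and its factorization\<close>

text \<open>The limit letter is read off a late word that has \<open>fib (Suc n)\<close> as a
  prefix. The \<open>Suc\<close> excludes \<open>fib 0 = [1]\<close>, which is not a prefix of
  \<open>fib_omega\<close>.\<close>

lemma fib_omega_nth:
  assumes "i < length (fib (Suc n))"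
  shows "fib_omega i = fib (Suc n) ! i"
proof -
  have "\<forall>\<^sub>F k in sequentially. k \<ge> n \<and> fib_word (int k) ! i = fib_omega i"
    using word_limit_fib_omega[unfolded word_limit_def, THEN spec[of _ i]]
    by (intro eventually_conj eventually_ge_at_top) (auto elim: eventually_mono)
  then obtain k where k: "k \<ge> n" "fib_word (int k) ! i = fib_omega i"
    using eventually_happens'[OF sequentially_bot] by blast
  have "Sublist.prefix (fib (Suc n)) (fib_word (int k))"
    using prefix_fib_word[OF k(1)] by (simp add: fib_def)
  then show ?thesis using assms k(2) by (auto simp: prefix_def nth_append)
qed

lemma prefix_if_prefixes_of_omega:
  assumes "w = x \<frown> v" "w = y \<frown> v'" "length x \<le> length y"
  shows "Sublist.prefix x y"
proof -
  have "x = take (length x) y"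
  proof (rule nth_equalityI)
    fix i assume i: "i < length x"
    then have "x ! i = w i" unfolding assms(1) by simp
    also have "w i = y ! i" unfolding assms(2) using i assms(3) by simp
    finally show "x ! i = take (length x) y ! i" using i by simp
  qed (use assms(3) in simp)
  then show ?thesis by (metis take_is_prefix)
qed

lemma fib_omega_butlast: "\<exists>v. fib_omega = butlast (fib (Suc n)) \<frown> v"
proof
  show "fib_omega = butlast (fib (Suc n)) \<frown> (\<lambda>i. fib_omega (i + length (butlast (fib (Suc n)))))"
    by (auto simp: conc_def fun_eq_iff nth_butlast fib_omega_nth)
qed

lemma is_arg_min_sing:
  "is_arg_min length
    (\<lambda>p. (\<exists>v. fib_omega = (butlast (fib (Suc n)) @ p) \<frown> v) \<and> closed_word p \<and>
      occurrences p (butlast (fib (Suc n)) @ p) = 1) (sing n)"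
  unfolding is_arg_min_def
proof (intro conjI notI)
  show "\<exists>v. fib_omega = (butlast (fib (Suc n)) @ sing n) \<frown> v"
    using fib_omega_butlast[of "Suc n"] by (simp add: butlast_fib_Suc_Suc)
  show "closed_word (sing n)" by (rule closed_sing)
  show "occurrences (sing n) (butlast (fib (Suc n)) @ sing n) = 1" by (rule occurrences_sing)
next
  assume "\<exists>p. ((\<exists>v. fib_omega = (butlast (fib (Suc n)) @ p) \<frown> v) \<and> closed_word p \<and>
      occurrences p (butlast (fib (Suc n)) @ p) = 1) \<and> length p < length (sing n)"
  then obtain p v where p: "fib_omega = (butlast (fib (Suc n)) @ p) \<frown> v" "closed_word p"
      "occurrences p (butlast (fib (Suc n)) @ p) = 1" "length p < length (sing n)"
    by blast
  \<comment> \<open>Both \<open>p\<close> and \<open>sing n\<close> continue the same prefix of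
    \<open>fib_omega\<close>, so the shorter \<open>p\<close> is a proper prefix of
    \<open>sing n\<close>.\<close>
  obtain v' where "fib_omega = (butlast (fib (Suc n)) @ sing n) \<frown> v'"
    using fib_omega_butlast[of "Suc n"] by (auto simp: butlast_fib_Suc_Suc)
  from prefix_if_prefixes_of_omega[OF p(1) this] p(4) have "Sublist.prefix p (sing n)" by simp
  then show False
    using strict_prefix_sing_occurs_before[of p n] p by (simp add: closed_word_def)
qed

lemma closed_z_factorization_sing: "closed_z_factorization fib_omega sing"
proof -
  have "word_limit (\<lambda>n. butlast (fib (Suc n))) fib_omega"
    unfolding word_limit_def
  proof
    fix i
    have "i < length (butlast (fib (Suc n))) \<and> butlast (fib (Suc n)) ! i = fib_omega i"
      if "Suc i \<le> n" for n
    proof -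
      have "i < length (butlast (fib (Suc n)))" using length_fib[of n] that by simp
      then show ?thesis using fib_omega_nth[of i n] by (simp add: nth_butlast)
    qed
    then show "\<forall>\<^sub>F n in sequentially.
        i < length (butlast (fib (Suc n))) \<and> butlast (fib (Suc n)) ! i = fib_omega i"
      by (rule eventually_sequentiallyI)
  qed
  then show ?thesis
    unfolding closed_z_factorization_def concat_sing using is_arg_min_sing by blast
qed

section \<open>Uniqueness of the factorization\<close>

lemma is_arg_min_value_unique:
  fixes f :: "'a \<Rightarrow> 'b :: linorder"
  assumes "is_arg_min f P x" "is_arg_min f P y"
  shows "f x = f y"
  using assms by (auto simp: is_arg_min_linorder intro: order_antisym)

text \<open>If all earlier factors agree, the next ones minimize length over the same candidates.
  Equal length and a common starting position in \<open>w\<close> then make them equal.\<close>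

lemma closed_z_factorization_unique:
  assumes "closed_z_factorization w y" "closed_z_factorization w z"
  shows "y = z"
proof
  fix i
  show "y i = z i"
  proof (induction i rule: less_induct)
    case (less i)
    let ?P = "concat (map z [0..<i])"
    let ?Q = "\<lambda>p. (\<exists>v. w = (?P @ p) \<frown> v) \<and> closed_word p \<and> occurrences p (?P @ p) = 1"
    have map_eq: "map y [0..<i] = map z [0..<i]" using less by simp
    have y: "is_arg_min length ?Q (y i)"
      using assms(1)[unfolded closed_z_factorization_def, THEN conjunct2, THEN spec, of i]
      unfolding map_eq .
    have z: "is_arg_min length ?Q (z i)"
      using assms(2)[unfolded closed_z_factorization_def, THEN conjunct2, THEN spec, of i] .
    obtain v where v: "w = (?P @ y i) \<frown> v"
      using y unfolding is_arg_min_def by (elim conjE exE)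
    obtain v' where v': "w = (?P @ z i) \<frown> v'"
      using z unfolding is_arg_min_def by (elim conjE exE)
    have len: "length (y i) = length (z i)"
      using y z by (rule is_arg_min_value_unique)
    have "Sublist.prefix (?P @ y i) (?P @ z i)"
      by (rule prefix_if_prefixes_of_omega[OF v v']) (simp add: len)
    moreover have "Sublist.prefix (?P @ z i) (?P @ y i)"
      by (rule prefix_if_prefixes_of_omega[OF v' v]) (simp add: len)
    ultimately have "?P @ y i = ?P @ z i" by (rule prefix_order.antisym)
    then show ?case by simp
  qed
qed

theorem theorem5:
  fixes z :: "nat \<Rightarrow> nat list"
  shows "closed_z_factorization fib_omega z \<longleftrightarrow> z = (\<lambda>i. singular_word (int i - 1))"
  unfolding singular_word_eq_sing
  using closed_z_factorization_sing closed_z_factorization_unique by metis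

end
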